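(* Let $\mathcal{H}_A,\mathcal{H}_B$ be complex Hilbert spaces of finite dimensions $d_A,d_B\ge 2$, and set $D_A=\frac{d_A-1}{d_A}$, $D_B=\frac{d_B-1}{d_B}$. Let $\rho_{AB}$ be a density operator on $\mathcal{H}_A\otimes\mathcal{H}_B$ with reduced states $\rho_A,\rho_B$. If $$S_L(\rho_A)\le D_A\Big(\frac{S_L(\rho_B)}{D_B}-1+2\sqrt{1-\frac{S_L(\rho_B)}{D_B}}\Big),$$ then $$S_L(\rho_{AB})\le S_L(\rho_A)+S_L(\rho_B)-2D_AD_B\Big(1-\sqrt{1-\frac{S_L(\rho_A)}{D_A}}\Big)\Big(1-\sqrt{1-\frac{S_L(\rho_B)}{D_B}}\Big).$$
   Context: A density operator (state) is a positive semidefinite operator of trace $1$. The linear entropy of a density operator $\rho$ is $S_L(\rho)=1-\operatorname{Tr}(\rho^2)$; on a $d$-dimensional space it satisfies $0\le S_L(\rho)\le 1-\frac1d$. The reduced states are the partial traces $\rho_A=\operatorname{Tr}_B(\rho_{AB})$ and $\rho_B=\operatorname{Tr}_A(\rho_{AB})$. *)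

theory Defs
  imports "HOL-Analysis.Analysis"
begin

text \<open>
  Operators on a finite-dimensional complex Hilbert space are given by their matrices with
  respect to an orthonormal basis indexed by a finite type. If \<open>'a\<close> and \<open>'b\<close> index orthonormal
  bases of two spaces, then \<open>'a \<times> 'b\<close> indexes the product basis \<open>e\<^sub>i \<otimes> f\<^sub>k\<close> of their tensor
  product.
\<close>

definition mat_adjoint :: "complex^'n^'m \<Rightarrow> complex^'m^'n" where
  "mat_adjoint A = (\<chi> i j. cnj (A $ j $ i))"

definition cinner_vec :: "complex^'n \<Rightarrow> complex^'n \<Rightarrow> complex" where
  "cinner_vec u v = (\<Sum>i\<in>UNIV. cnj (u $ i) * v $ i)"

text \<open>For self-adjoint \<open>A\<close> the form \<open>cinner_vec v (A *v v)\<close> is real, so \<open>Re\<close> loses nothing.\<close>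

definition positive_semidefinite :: "complex^'n^'n \<Rightarrow> bool" where
  "positive_semidefinite A \<longleftrightarrow>
     mat_adjoint A = A \<and> (\<forall>v. 0 \<le> Re (cinner_vec v (A *v v)))"

definition density_operator :: "complex^'n^'n \<Rightarrow> bool" where
  "density_operator \<rho> \<longleftrightarrow> positive_semidefinite \<rho> \<and> trace \<rho> = 1"

text \<open>The trace of the square of a self-adjoint matrix is real.\<close>

definition linear_entropy :: "complex^'n^'n \<Rightarrow> real" where
  "linear_entropy \<rho> = 1 - Re (trace (\<rho> ** \<rho>))"

definition partial_trace_B :: "complex^('a::finite \<times> 'b::finite)^('a \<times> 'b) \<Rightarrow> complex^'a^'a" where
  "partial_trace_B \<rho> = (\<chi> i j. \<Sum>k\<in>UNIV. \<rho> $ (i, k) $ (j, k))"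

definition partial_trace_A :: "complex^('a::finite \<times> 'b::finite)^('a \<times> 'b) \<Rightarrow> complex^'b^'b" where
  "partial_trace_A \<rho> = (\<chi> k l. \<Sum>i\<in>UNIV. \<rho> $ (i, k) $ (i, l))"

end

theory Submission
  imports Defs
begin

text \<open>
  With \<open>x = sqrt (1 - S(\<rho>\<^sub>A)/D\<^sub>A)\<close> and \<open>y = sqrt (1 - S(\<rho>\<^sub>B)/D\<^sub>B)\<close> the reduced states have Bloch
  decompositions \<open>\<rho>\<^sub>A = 1/d\<^sub>A + x A\<close>, \<open>\<rho>\<^sub>B = 1/d\<^sub>B + y B\<close> with \<open>A\<close>, \<open>B\<close> Hermitian, traceless and of squared
  Hilbert--Schmidt norm \<open>D\<^sub>A\<close>, \<open>D\<^sub>B\<close>. The hypothesis says \<open>x + y \<ge> 1\<close>, and the conclusion says that the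
  part \<open>C\<close> of \<open>\<rho>\<^sub>A\<^sub>B\<close> orthogonal to all \<open>M \<otimes> 1\<close> and \<open>1 \<otimes> N\<close> has squared norm at least
  \<open>D\<^sub>A D\<^sub>B (x + y - 1)\<^sup>2\<close>. By Cauchy--Schwarz \<open>A \<le> D\<^sub>A\<close> and \<open>B \<le> D\<^sub>B\<close>, so
  \<open>(D\<^sub>A - A) \<otimes> (D\<^sub>B - B)\<close> is positive semidefinite; its expectation in \<open>\<rho>\<^sub>A\<^sub>B\<close> being nonnegative means
  \<open>\<langle>C, A \<otimes> B\<rangle> \<ge> D\<^sub>A D\<^sub>B (x + y - 1)\<close>, and a second application of Cauchy--Schwarz bounds the norm
  of \<open>C\<close>.
\<close>

section \<open>Hermitian and positive semidefinite matrices\<close>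

text \<open>The library's real inner product on matrices is the real part of the Hilbert--Schmidt
  product, so the real Cauchy--Schwarz inequality applies to it directly.\<close>

lemma inner_matrix_eq:
  fixes A B :: "complex^'n::finite^'m::finite"
  shows "inner A B = Re (\<Sum>i\<in>UNIV. \<Sum>j\<in>UNIV. cnj (A $ i $ j) * B $ i $ j)"
  by (simp add: inner_vec_def inner_complex_def)

lemma mat_adjoint_eq_iff: "mat_adjoint A = A \<longleftrightarrow> (\<forall>i j. cnj (A $ j $ i) = A $ i $ j)"
  by (simp add: mat_adjoint_def vec_eq_iff)

lemma hermitian_entry:
  assumes "mat_adjoint A = A"
  shows "cnj (A $ i $ j) = A $ j $ i"
  using assms by (simp add: mat_adjoint_eq_iff)

text \<open>Conjugation only interchanges the two summation indices, so the Hilbert--Schmidt product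
  of Hermitian matrices is already real.\<close>

lemma inner_hermitian:
  fixes A B :: "complex^'n::finite^'n"
  assumes "mat_adjoint A = A" "mat_adjoint B = B"
  shows "(\<Sum>i\<in>UNIV. \<Sum>j\<in>UNIV. cnj (A $ i $ j) * B $ i $ j) = complex_of_real (inner A B)"
proof -
  let ?s = "\<Sum>i\<in>UNIV. \<Sum>j\<in>UNIV. cnj (A $ i $ j) * B $ i $ j"
  have "cnj ?s = (\<Sum>i\<in>UNIV. \<Sum>j\<in>UNIV. cnj (A $ j $ i) * B $ j $ i)"
    using assms by (simp add: hermitian_entry)
  also have "\<dots> = ?s"
    by (rule sum.swap)
  finally have "?s \<in> \<real>"
    by (simp add: Reals_cnj_iff)
  then show ?thesis
    by (simp only: inner_matrix_eq of_real_Re)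
qed

lemma inner_mat_1:
  fixes A :: "complex^'n::finite^'n"
  shows "inner A (mat 1) = Re (trace A)"
  by (simp add: inner_matrix_eq trace_def mat_def if_distrib cong: if_cong)

lemma inner_self_eq_trace:
  fixes A :: "complex^'n::finite^'n"
  assumes "mat_adjoint A = A"
  shows "inner A A = Re (trace (A ** A))"
proof -
  have "trace (A ** A) = (\<Sum>i\<in>UNIV. \<Sum>j\<in>UNIV. cnj (A $ j $ i) * A $ j $ i)"
    using assms by (simp add: trace_def matrix_matrix_mult_def hermitian_entry)
  also have "\<dots> = (\<Sum>i\<in>UNIV. \<Sum>j\<in>UNIV. cnj (A $ i $ j) * A $ i $ j)"
    by (rule sum.swap)
  finally show ?thesis
    by (simp add: inner_matrix_eq)
qed

section \<open>Rank one matrices and quadratic forms\<close>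

definition rank_one :: "complex^'n \<Rightarrow> complex^'n^'n" where
  "rank_one v = (\<chi> i j. v $ i * cnj (v $ j))"

lemma inner_rank_one:
  fixes A :: "complex^'n::finite^'n"
  shows "inner A (rank_one v) = Re (cinner_vec v (A *v v))"
proof -
  have "cinner_vec v (A *v v) = cnj (\<Sum>i\<in>UNIV. \<Sum>j\<in>UNIV. cnj (A $ i $ j) * (v $ i * cnj (v $ j)))"
    by (simp add: cinner_vec_def matrix_vector_mult_def sum_distrib_left mult_ac)
  then show ?thesis
    by (simp only: inner_matrix_eq rank_one_def vec_lambda_beta cnj.simps(1))
qed

lemma mat_adjoint_rank_one: "mat_adjoint (rank_one v) = rank_one v"
  by (simp add: mat_adjoint_eq_iff rank_one_def)

text \<open>Turns positivity into a family of inequalities linear in \<open>A\<close>, the form used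
  from here on.\<close>

lemma positive_semidefinite_iff:
  "positive_semidefinite A \<longleftrightarrow> mat_adjoint A = A \<and> (\<forall>v. 0 \<le> inner A (rank_one v))"
  by (simp add: positive_semidefinite_def inner_rank_one)

lemma inner_rank_one_rank_one:
  fixes u v :: "complex^'n::finite"
  shows "inner (rank_one u) (rank_one v) = (cmod (cinner_vec u v))\<^sup>2"
proof -
  have "(\<Sum>i\<in>UNIV. \<Sum>j\<in>UNIV. cnj (rank_one u $ i $ j) * rank_one v $ i $ j)
      = (\<Sum>i\<in>UNIV. \<Sum>j\<in>UNIV. (cnj (u $ i) * v $ i) * cnj (cnj (u $ j) * v $ j))"
    by (simp add: rank_one_def mult_ac)
  also have "\<dots> = cinner_vec u v * cnj (cinner_vec u v)"
    by (simp only: cinner_vec_def cnj_sum sum_product)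
  finally have "(\<Sum>i\<in>UNIV. \<Sum>j\<in>UNIV. cnj (rank_one u $ i $ j) * rank_one v $ i $ j)
      = cinner_vec u v * cnj (cinner_vec u v)" .
  then show ?thesis
    by (simp add: inner_matrix_eq complex_norm_square[symmetric] del: of_real_power
      flip: of_real_power)
qed

section \<open>Positive semidefinite matrices as sums of rank one matrices\<close>

lemma cinner_vec_axis:
  fixes u :: "complex^'n::finite"
  shows "cinner_vec (axis s 1) u = u $ s"
proof -
  have "cinner_vec (axis s 1) u = (\<Sum>i\<in>UNIV. if i = s then u $ i else 0)"
    unfolding cinner_vec_def by (intro sum.cong) (auto simp: axis_def)
  then show ?thesis by simp
qed

lemma matrix_vector_mult_axis:
  fixes A :: "complex^'n::finite^'m"
  shows "(A *v axis s 1) $ i = A $ i $ s"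
proof -
  have "(A *v axis s 1) $ i = (\<Sum>j\<in>UNIV. if j = s then A $ i $ j else 0)"
    unfolding matrix_vector_mult_def vec_lambda_beta by (intro sum.cong) (auto simp: axis_def)
  then show ?thesis by simp
qed

text \<open>The Cauchy--Schwarz inequality of the semi-inner product of \<open>A\<close>, for the vectors \<open>e\<^sub>s\<close>
  and \<open>v\<close>; by evaluating the form at \<open>v - k (Av)\<^sub>s e\<^sub>s\<close>.\<close>

lemma psd_cauchy_schwarz_axis:
  fixes A :: "complex^'n::finite^'n"
  assumes "positive_semidefinite A"
  shows "(cmod ((A *v v) $ s))\<^sup>2 \<le> Re (A $ s $ s) * inner A (rank_one v)"
proof -
  define c where "c = (A *v v) $ s"
  define m where "m = Re (A $ s $ s)"
  have herm: "mat_adjoint A = A" and pos: "\<And>u. 0 \<le> Re (cinner_vec u (A *v u))"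
    using assms by (auto simp: positive_semidefinite_def)
  have "cnj (A $ s $ s) = A $ s $ s"
    by (rule hermitian_entry[OF herm])
  then have m: "A $ s $ s = of_real m"
    unfolding m_def by (metis Reals_cnj_iff of_real_Re)
  have col: "(\<Sum>i\<in>UNIV. cnj (v $ i) * A $ i $ s) = cnj c"
    unfolding c_def matrix_vector_mult_def
    using herm by (simp add: hermitian_entry mult.commute)
  have expand: "Re (cinner_vec (v - (of_real k * c) *s axis s 1) (A *v (v - (of_real k * c) *s axis s 1)))
      = inner A (rank_one v) - 2 * k * (cmod c)\<^sup>2 + k\<^sup>2 * (cmod c)\<^sup>2 * m" for k
  proof -
    define z where "z = of_real k * c"
    have Av: "(A *v (v - z *s axis s 1)) $ i = (A *v v) $ i - z * A $ i $ s" for i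
      by (simp add: matrix_vector_mult_diff_distrib vector_scalar_commute
          matrix_vector_mult_axis)
    have "cinner_vec (v - z *s axis s 1) (A *v (v - z *s axis s 1))
      = (\<Sum>i\<in>UNIV. (cnj (v $ i) - (if i = s then cnj z else 0)) * ((A *v v) $ i - z * A $ i $ s))"
      unfolding cinner_vec_def Av by (intro sum.cong) (auto simp: axis_def)
    also have "\<dots> = (\<Sum>i\<in>UNIV. cnj (v $ i) * (A *v v) $ i) - z * (\<Sum>i\<in>UNIV. cnj (v $ i) * A $ i $ s)
        - cnj z * (c - z * of_real m)"
      by (simp add: left_diff_distrib right_diff_distrib sum_subtractf sum_distrib_left
          if_distrib[of "\<lambda>x. x * _"] if_distrib[of "\<lambda>x. _ * x"] c_def m mult_ac cong: if_cong)
    also have "\<dots> = cinner_vec v (A *v v) - z * cnj c - cnj z * (c - z * of_real m)"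
      by (simp add: col cinner_vec_def)
    also have "\<dots> = cinner_vec v (A *v v) - of_real (2 * k - k\<^sup>2 * m) * (c * cnj c)"
      by (simp add: z_def algebra_simps power2_eq_square)
    also have "Re \<dots> = inner A (rank_one v) - (2 * k - k\<^sup>2 * m) * (cmod c)\<^sup>2"
      by (simp add: complex_norm_square[symmetric] inner_rank_one del: of_real_power
          flip: of_real_power of_real_mult of_real_diff)
    finally show ?thesis
      by (simp add: z_def algebra_simps)
  qed
  define q where "q = inner A (rank_one v)"
  have quad: "0 \<le> q - 2 * k * (cmod c)\<^sup>2 + k\<^sup>2 * (cmod c)\<^sup>2 * m" for k
    using pos[of "v - (of_real k * c) *s axis s 1"] unfolding expand q_def .
  have "0 \<le> m"
    using pos[of "axis s 1"]
    by (simp add: m_def cinner_vec_axis matrix_vector_mult_axis)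
  have "(cmod c)\<^sup>2 \<le> m * q"
  proof (cases "m = 0")
    case True
    show ?thesis
    proof (cases "c = 0")
      \<comment> \<open>For \<open>m = 0\<close> the bound \<open>quad\<close> is affine in
        \<open>k\<close>; the chosen \<open>k\<close> would make its right-hand side -1.\<close>
      case False
      then show ?thesis
        using quad[of "(q + 1) / (2 * (cmod c)\<^sup>2)"] True by (simp add: field_simps)
    qed (use True in simp)
  next
    case False
    then have "0 < m" using \<open>0 \<le> m\<close> by simp
    \<comment> \<open>\<open>k = 1 / m\<close> minimises the quadratic, with value \<open>q\<close>
      minus the squared modulus of \<open>c\<close> over \<open>m\<close>.\<close>
    with quad[of "1 / m"] show ?thesis
      by (simp add: field_simps power2_eq_square)
  qed
  then show ?thesis
    by (simp add: c_def m_def q_def)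
qed

text \<open>The summands are the columns of an incomplete Cholesky factor: each step subtracts the
  rank one matrix that clears row and column \<open>s\<close> and leaves the (positive semidefinite) Schur
  complement. If \<open>A $ s $ s = 0\<close> then the row vanishes already, and division by zero makes the
  subtracted matrix zero.\<close>

lemma psd_rank_one_decomposition_support:
  fixes A :: "complex^'n::finite^'n"
  assumes "finite S" "positive_semidefinite A" "\<And>i j. i \<notin> S \<Longrightarrow> A $ i $ j = 0"
  shows "\<exists>V. A = (\<Sum>s\<in>S. rank_one (V s))"
  using assms
proof (induction S arbitrary: A rule: finite_induct)
  case empty
  then show ?case by (simp add: vec_eq_iff)
next
  case (insert s S)
  define m where "m = Re (A $ s $ s)"
  define w where "w = (\<chi> i. A $ i $ s / of_real (sqrt m))"
  have herm: "mat_adjoint A = A" and pos: "\<And>u. 0 \<le> inner A (rank_one u)"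
    using insert.prems(1) by (auto simp: positive_semidefinite_iff)
  note entry = hermitian_entry[OF herm]
  note cs = psd_cauchy_schwarz_axis[OF insert.prems(1)]
  have m: "A $ s $ s = of_real m"
    unfolding m_def by (metis Reals_cnj_iff of_real_Re entry)
  have "0 \<le> m"
    using pos[of "axis s 1"]
    by (simp add: m_def inner_rank_one cinner_vec_axis matrix_vector_mult_axis)
  have ww: "rank_one w $ i $ j = A $ i $ s * A $ s $ j / of_real m" for i j
    using \<open>0 \<le> m\<close> by (simp add: rank_one_def w_def entry flip: of_real_mult)
  have row: "A $ s $ j = 0" if "m = 0" for j
    using cs[of "axis j 1" s] that by (simp add: matrix_vector_mult_axis m)
  define A' where "A' = A - rank_one w"
  have "mat_adjoint A' = A'"
    using entry by (simp add: A'_def mat_adjoint_eq_iff ww mult.commute m)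
  moreover have "0 \<le> inner A' (rank_one v)" for v
  proof -
    \<comment> \<open>The form of the subtracted matrix at \<open>v\<close> is the squared modulus
      of \<open>(A *v v) $ s\<close> over \<open>m\<close>, so positivity of the Schur complement is
      exactly \<open>cs\<close>.\<close>
    have "cinner_vec w v = (A *v v) $ s / of_real (sqrt m)"
      by (simp add: cinner_vec_def w_def matrix_vector_mult_def entry sum_divide_distrib)
    then have "inner (rank_one w) (rank_one v) = (cmod ((A *v v) $ s))\<^sup>2 / m"
      using \<open>0 \<le> m\<close> by (simp add: inner_rank_one_rank_one norm_divide power_divide)
    also have "\<dots> \<le> inner A (rank_one v)"
      using cs[of v s, folded m_def] \<open>0 \<le> m\<close> pos[of v] by (cases "m = 0") (auto simp: field_simps)
    finally show ?thesis
      by (simp add: A'_def inner_diff_left)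
  qed
  ultimately have "positive_semidefinite A'"
    by (simp add: positive_semidefinite_iff)
  moreover have "A' $ i $ j = 0" if "i \<notin> S" for i j
    using that insert.prems(2)[of i] row[of j] by (cases "i = s") (auto simp: A'_def ww m)
  ultimately obtain V where V: "A' = (\<Sum>s\<in>S. rank_one (V s))"
    using insert.IH by blast
  have "(\<Sum>t\<in>S. rank_one ((V(s := w)) t)) = A'"
    unfolding V using insert.hyps(2) by (intro sum.cong) auto
  then have "A = (\<Sum>t\<in>insert s S. rank_one ((V(s := w)) t))"
    using insert.hyps by (simp add: A'_def)
  then show ?case by blast
qed

text \<open>Stands in for the spectral theorem; the vectors need not be orthogonal.\<close>

lemma psd_rank_one_decomposition:
  fixes A :: "complex^'n::finite^'n"
  assumes "positive_semidefinite A"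
  obtains V :: "'n \<Rightarrow> complex^'n" where "A = (\<Sum>s\<in>UNIV. rank_one (V s))"
  using psd_rank_one_decomposition_support[of UNIV A] assms by auto

section \<open>Traceless Hermitian matrices and the Bloch decomposition\<close>

lemma cinner_vec_self:
  fixes v :: "complex^'n::finite"
  shows "cinner_vec v v = of_real (inner v v)"
  by (simp add: cinner_vec_def inner_vec_def complex_eq_iff inner_complex_def)

lemma inner_mat_1_mat_1: "inner (mat 1 :: complex^'n::finite^'n) (mat 1) = real CARD('n)"
  by (simp only: inner_mat_1) (simp add: trace_def mat_def)

lemma inner_mat_1_rank_one:
  fixes v :: "complex^'n::finite"
  shows "inner (mat 1) (rank_one v) = inner v v"
  by (simp add: inner_rank_one cinner_vec_self)

lemma mat_adjoint_mat_1: "mat_adjoint (mat 1) = mat 1"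
  by (simp add: mat_adjoint_eq_iff mat_def)

lemma mat_adjoint_diff: "mat_adjoint (A - B) = mat_adjoint A - mat_adjoint B"
  by (simp add: mat_adjoint_def vec_eq_iff)

lemma mat_adjoint_scaleR: "mat_adjoint (r *\<^sub>R A) = r *\<^sub>R mat_adjoint A"
  by (simp add: mat_adjoint_def vec_eq_iff)

text \<open>A traceless \<open>A\<close> pairs only with the traceless part \<open>P\<close> of
  \<open>rank_one v\<close>. The norm of \<open>P\<close> is \<open>sqrt D * inner v v\<close> and
  that of \<open>A\<close> is \<open>sqrt D\<close>, so Cauchy--Schwarz yields the factor
  \<open>D\<close>.\<close>

lemma psd_mat_1_minus_traceless:
  fixes A :: "complex^'n::finite^'n"
  assumes "mat_adjoint A = A" "inner A (mat 1) = 0" "inner A A = D"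
    and D: "D = (real CARD('n) - 1) / real CARD('n)"
  shows "positive_semidefinite (D *\<^sub>R mat 1 - A)"
proof -
  have "inner A (rank_one v) \<le> D * inner v v" for v
  proof -
    define s where "s = inner v v"
    define P where "P = rank_one v - (s / real CARD('n)) *\<^sub>R mat 1"
    have "0 \<le> s" by (simp add: s_def)
    have "0 \<le> D" using D by simp
    have "inner P P = D * s\<^sup>2"
      by (simp add: P_def inner_diff_left inner_diff_right inner_mat_1_mat_1 inner_mat_1_rank_one
          inner_commute[of "rank_one v" "mat 1"] inner_rank_one_rank_one cinner_vec_self D
          flip: s_def) (simp add: field_simps power2_eq_square)
    then have "norm A * norm P = D * s"
      using assms(3) \<open>0 \<le> s\<close> \<open>0 \<le> D\<close> by (simp add: norm_eq_sqrt_inner real_sqrt_mult)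
    moreover have "inner A P = inner A (rank_one v)"
      by (simp add: P_def inner_diff_right assms(2))
    ultimately show ?thesis
      using norm_cauchy_schwarz[of A P] by (simp add: s_def)
  qed
  then show ?thesis
    by (simp add: positive_semidefinite_iff mat_adjoint_diff mat_adjoint_scaleR mat_adjoint_mat_1
        assms(1) inner_diff_left inner_mat_1_rank_one)
qed

text \<open>If the state is maximally mixed, the direction of its Bloch vector is arbitrary.\<close>

lemma bloch_decomposition:
  fixes \<rho> :: "complex^'n::finite^'n"
  assumes herm: "mat_adjoint \<rho> = \<rho>" and tr: "trace \<rho> = 1"
    and card: "CARD('n) \<ge> 2" and D: "D = (real CARD('n) - 1) / real CARD('n)"
  defines "x \<equiv> sqrt (1 - linear_entropy \<rho> / D)"
  obtains A where "mat_adjoint A = A" "inner A (mat 1) = 0" "inner A A = D"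
    "\<rho> = (1 / real CARD('n)) *\<^sub>R mat 1 + x *\<^sub>R A" "0 \<le> x" "linear_entropy \<rho> = D * (1 - x\<^sup>2)"
proof -
  define d where "d = real CARD('n)"
  define G where "G = \<rho> - (1 / d) *\<^sub>R mat 1"
  have "2 \<le> d" using card by (simp add: d_def)
  have Dd: "D = 1 - 1 / d" using \<open>2 \<le> d\<close> by (simp add: D d_def[symmetric] field_simps)
  have "1 / d < 1" using \<open>2 \<le> d\<close> by simp
  then have "0 < D" by (simp add: Dd)
  have trG: "inner G (mat 1) = 0"
    using \<open>2 \<le> d\<close>
    by (simp add: G_def inner_diff_left inner_mat_1_mat_1 inner_mat_1[of \<rho>] tr flip: d_def)
  have hermG: "mat_adjoint G = G"
    by (simp add: G_def mat_adjoint_diff mat_adjoint_scaleR mat_adjoint_mat_1 herm)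
  have "inner G G = inner \<rho> \<rho> - 1 / d"
    using \<open>2 \<le> d\<close>
    by (simp add: G_def inner_diff_left inner_diff_right inner_mat_1_mat_1
        inner_commute[of "mat 1" \<rho>] inner_mat_1[of \<rho>] tr flip: d_def)
  also have "\<dots> = D * (1 - linear_entropy \<rho> / D)"
  proof -
    have "D * (1 - linear_entropy \<rho> / D) = D - linear_entropy \<rho>"
      using \<open>0 < D\<close> by (simp add: right_diff_distrib)
    then show ?thesis
      by (simp add: linear_entropy_def inner_self_eq_trace[OF herm] Dd)
  qed
  finally have GG: "inner G G = D * (1 - linear_entropy \<rho> / D)" .
  \<comment> \<open>This is the bound of the linear entropy by \<open>D\<close>, read off from a
    squared norm; it ensures that squaring \<open>x\<close> recovers the radicand.\<close>
  then have nonneg: "0 \<le> 1 - linear_entropy \<rho> / D"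
    using \<open>0 < D\<close> inner_ge_zero[of G] by (simp add: zero_le_mult_iff)
  then have GG: "inner G G = D * x\<^sup>2"
    using GG by (simp add: x_def)
  have "0 \<le> x" "linear_entropy \<rho> = D * (1 - x\<^sup>2)"
    using nonneg \<open>0 < D\<close> by (simp_all add: x_def)
  note that = that[OF _ _ _ _ this]
  show thesis
  proof (cases "x = 0")
    case True
    \<comment> \<open>Here \<open>GG\<close> forces \<open>G = 0\<close>, so any direction serves:
      the traceless part of a projection onto a basis vector has squared norm
      \<open>D\<close>.\<close>
    define s where "s = (undefined :: 'n)"
    define A :: "complex^'n^'n" where "A = rank_one (axis s 1) - (1 / d) *\<^sub>R mat 1"
    have [simp]: "inner (axis s 1 :: complex^'n) (axis s 1) = 1"
      by (simp add: inner_axis_axis)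
    show thesis
    proof (rule that)
      show "mat_adjoint A = A"
        by (simp add: A_def mat_adjoint_diff mat_adjoint_scaleR mat_adjoint_mat_1
            mat_adjoint_rank_one)
      show "inner A (mat 1) = 0"
        using \<open>2 \<le> d\<close> by (simp add: A_def inner_diff_left inner_mat_1_mat_1
            inner_commute[of "rank_one _" "mat 1"] inner_mat_1_rank_one flip: d_def)
      show "inner A A = D"
        using \<open>2 \<le> d\<close>
        by (simp add: A_def inner_diff_left inner_diff_right inner_mat_1_mat_1
            inner_commute[of "rank_one _" "mat 1"] inner_mat_1_rank_one Dd inner_rank_one_rank_one
            cinner_vec_self flip: d_def)
      show "\<rho> = (1 / real CARD('n)) *\<^sub>R mat 1 + x *\<^sub>R A"
        using GG True by (simp add: G_def flip: d_def)
    qed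
  next
    case False
    show thesis
    proof (rule that)
      show "mat_adjoint ((1 / x) *\<^sub>R G) = (1 / x) *\<^sub>R G"
        by (simp add: mat_adjoint_scaleR hermG)
      show "inner ((1 / x) *\<^sub>R G) (mat 1) = 0"
        by (simp add: trG)
      show "inner ((1 / x) *\<^sub>R G) ((1 / x) *\<^sub>R G) = D"
        using False by (simp add: GG power2_eq_square)
      show "\<rho> = (1 / real CARD('n)) *\<^sub>R mat 1
          + x *\<^sub>R ((1 / x) *\<^sub>R G)"
        using False by (simp add: G_def flip: d_def)
    qed
  qed
qed

section \<open>Tensor products\<close>

definition kron :: "complex^'a^'a \<Rightarrow> complex^'b^'b \<Rightarrow> complex^('a::finite \<times> 'b::finite)^('a \<times> 'b)" where
  "kron M N = (\<chi> p q. M $ fst p $ fst q * N $ snd p $ snd q)"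

lemma kron_diff_left: "kron (M - M') N = kron M N - kron M' N"
  by (simp add: kron_def vec_eq_iff left_diff_distrib)

lemma kron_diff_right: "kron M (N - N') = kron M N - kron M N'"
  by (simp add: kron_def vec_eq_iff right_diff_distrib)

lemma kron_scaleR_left: "kron (r *\<^sub>R M) N = r *\<^sub>R kron M N"
  by (simp add: kron_def vec_eq_iff)

lemma kron_scaleR_right: "kron M (r *\<^sub>R N) = r *\<^sub>R kron M N"
  by (simp add: kron_def vec_eq_iff)

lemma kron_sum_left: "kron (\<Sum>s\<in>S. M s) N = (\<Sum>s\<in>S. kron (M s) N)"
  by (simp add: kron_def vec_eq_iff sum_distrib_right)

lemma kron_sum_right: "kron M (\<Sum>s\<in>S. N s) = (\<Sum>s\<in>S. kron M (N s))"
  by (simp add: kron_def vec_eq_iff sum_distrib_left)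

lemma kron_mat_1_mat_1: "kron (mat 1) (mat 1) = mat 1"
  by (simp add: kron_def vec_eq_iff mat_def prod_eq_iff)

lemma kron_rank_one: "kron (rank_one v) (rank_one w) = rank_one (\<chi> p. v $ fst p * w $ snd p)"
  by (simp add: kron_def rank_one_def vec_eq_iff mult_ac)

lemma sum_UNIV_prod:
  fixes f :: "'a::finite \<times> 'b::finite \<Rightarrow> 'c::comm_monoid_add"
  shows "(\<Sum>p\<in>UNIV. f p) = (\<Sum>i\<in>UNIV. \<Sum>k\<in>UNIV. f (i, k))"
  by (simp add: sum.cartesian_product flip: UNIV_Times_UNIV)

text \<open>The complex Hilbert--Schmidt product factorises. Its real part factorises too because
  the first factor is real, which is why \<open>M\<close> and \<open>M'\<close> are
  Hermitian.\<close>

lemma inner_kron_kron: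
  fixes M M' :: "complex^'a::finite^'a" and N N' :: "complex^'b::finite^'b"
  assumes "mat_adjoint M = M" "mat_adjoint M' = M'"
  shows "inner (kron M N) (kron M' N') = inner M M' * inner N N'"
proof -
  let ?s = "\<Sum>k\<in>UNIV. \<Sum>l\<in>UNIV. cnj (N $ k $ l) * N' $ k $ l"
  have "(\<Sum>p\<in>UNIV. \<Sum>q\<in>UNIV. cnj (kron M N $ p $ q) * kron M' N' $ p $ q)
     = (\<Sum>i\<in>UNIV. \<Sum>k\<in>UNIV. \<Sum>j\<in>UNIV. \<Sum>l\<in>UNIV.
          (cnj (M $ i $ j) * M' $ i $ j) * (cnj (N $ k $ l) * N' $ k $ l))"
    by (simp add: kron_def sum_UNIV_prod mult_ac)
  also have "\<dots> = (\<Sum>i\<in>UNIV. \<Sum>j\<in>UNIV. \<Sum>k\<in>UNIV. \<Sum>l\<in>UNIV.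
          (cnj (M $ i $ j) * M' $ i $ j) * (cnj (N $ k $ l) * N' $ k $ l))"
    by (intro sum.cong refl sum.swap)
  also have "\<dots> = (\<Sum>i\<in>UNIV. \<Sum>j\<in>UNIV. cnj (M $ i $ j) * M' $ i $ j) * ?s"
    by (simp only: sum_distrib_right) (simp only: sum_distrib_left)
  also have "\<dots> = of_real (inner M M') * ?s"
    by (simp only: inner_hermitian[OF assms])
  finally have "(\<Sum>p\<in>UNIV. \<Sum>q\<in>UNIV. cnj (kron M N $ p $ q) * kron M' N' $ p $ q)
    = of_real (inner M M') * ?s" .
  then show ?thesis
    by (simp only: inner_matrix_eq[of "kron M N"] inner_matrix_eq[of N]) simp
qed

text \<open>The partial trace is the adjoint of tensoring with the identity; this yields the
  components of \<open>\<rho>\<close> along local observables.\<close>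

lemma inner_kron_mat_1_right:
  fixes \<rho> :: "complex^('a::finite \<times> 'b::finite)^('a \<times> 'b)"
  shows "inner \<rho> (kron M (mat 1)) = inner (partial_trace_B \<rho>) M"
proof -
  have "inner \<rho> (kron M (mat 1))
     = Re (\<Sum>i\<in>UNIV. \<Sum>k\<in>UNIV. \<Sum>j\<in>UNIV. cnj (\<rho> $ (i, k) $ (j, k)) * M $ i $ j)"
    by (simp only: inner_matrix_eq)
      (simp add: kron_def mat_def sum_UNIV_prod if_distrib cong: if_cong)
  also have "\<dots> = Re (\<Sum>i\<in>UNIV. \<Sum>j\<in>UNIV. \<Sum>k\<in>UNIV. cnj (\<rho> $ (i, k) $ (j, k)) * M $ i $ j)"
    by (rule arg_cong[of _ _ Re], rule sum.cong[OF refl], rule sum.swap)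
  finally show ?thesis
    by (simp add: inner_matrix_eq partial_trace_B_def sum_distrib_right)
qed

lemma inner_kron_mat_1_left:
  fixes \<rho> :: "complex^('a::finite \<times> 'b::finite)^('a \<times> 'b)"
  shows "inner \<rho> (kron (mat 1) N) = inner (partial_trace_A \<rho>) N"
proof -
  have "inner \<rho> (kron (mat 1) N)
     = Re (\<Sum>i\<in>UNIV. \<Sum>k\<in>UNIV. \<Sum>l\<in>UNIV. cnj (\<rho> $ (i, k) $ (i, l)) * N $ k $ l)"
  proof -
    have "(\<Sum>j\<in>UNIV. \<Sum>l\<in>UNIV. cnj (\<rho> $ (i, k) $ (j, l)) * kron (mat 1) N $ (i, k) $ (j, l))
      = (\<Sum>j\<in>UNIV. if j = i then \<Sum>l\<in>UNIV. cnj (\<rho> $ (i, k) $ (j, l)) * N $ k $ l else 0)" for i k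
      by (intro sum.cong) (auto simp: kron_def mat_def)
    then show ?thesis
      by (simp add: inner_matrix_eq sum_UNIV_prod)
  qed
  also have "\<dots> = Re (\<Sum>k\<in>UNIV. \<Sum>i\<in>UNIV. \<Sum>l\<in>UNIV. cnj (\<rho> $ (i, k) $ (i, l)) * N $ k $ l)"
    by (rule arg_cong[of _ _ Re], rule sum.swap)
  also have "\<dots> = Re (\<Sum>k\<in>UNIV. \<Sum>l\<in>UNIV. \<Sum>i\<in>UNIV. cnj (\<rho> $ (i, k) $ (i, l)) * N $ k $ l)"
    by (rule arg_cong[of _ _ Re], rule sum.cong[OF refl], rule sum.swap)
  finally show ?thesis
    by (simp add: inner_matrix_eq partial_trace_A_def sum_distrib_right)
qed

text \<open>Decomposing both factors turns \<open>kron M N\<close> into a sum of rank one matrices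
  of product vectors, on each of which \<open>\<rho>\<close> is nonnegative.\<close>

lemma inner_kron_psd_nonneg:
  fixes \<rho> :: "complex^('a::finite \<times> 'b::finite)^('a \<times> 'b)"
  assumes "positive_semidefinite \<rho>" "positive_semidefinite M" "positive_semidefinite N"
  shows "0 \<le> inner \<rho> (kron M N)"
proof -
  obtain V :: "'a \<Rightarrow> complex^'a" where "M = (\<Sum>s\<in>UNIV. rank_one (V s))"
    using psd_rank_one_decomposition[OF assms(2)] .
  moreover obtain W :: "'b \<Rightarrow> complex^'b" where "N = (\<Sum>t\<in>UNIV. rank_one (W t))"
    using psd_rank_one_decomposition[OF assms(3)] .
  ultimately show ?thesis
    using assms(1)
    by (simp add: kron_sum_left kron_sum_right kron_rank_one inner_sum_right sum_nonneg
        positive_semidefinite_iff)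
qed

section \<open>Reduced states are Hermitian of trace one\<close>

lemma mat_adjoint_partial_trace_B:
  "mat_adjoint \<rho> = \<rho> \<Longrightarrow> mat_adjoint (partial_trace_B \<rho>) = partial_trace_B \<rho>"
  by (simp add: mat_adjoint_eq_iff partial_trace_B_def)

lemma mat_adjoint_partial_trace_A:
  "mat_adjoint \<rho> = \<rho> \<Longrightarrow> mat_adjoint (partial_trace_A \<rho>) = partial_trace_A \<rho>"
  by (simp add: mat_adjoint_eq_iff partial_trace_A_def)

lemma trace_partial_trace_B: "trace (partial_trace_B \<rho>) = trace \<rho>"
  by (simp add: trace_def partial_trace_B_def sum_UNIV_prod)

lemma trace_partial_trace_A: "trace (partial_trace_A \<rho>) = trace \<rho>"
proof -
  have "trace (partial_trace_A \<rho>) = (\<Sum>k\<in>UNIV. \<Sum>i\<in>UNIV. \<rho> $ (i, k) $ (i, k))"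
    by (simp add: trace_def partial_trace_A_def)
  also have "\<dots> = trace \<rho>"
    by (subst sum.swap) (simp add: trace_def sum_UNIV_prod)
  finally show ?thesis .
qed

section \<open>The purity bound\<close>

lemma purity_lower_bound:
  fixes \<rho> :: "complex^('a::finite \<times> 'b::finite)^('a \<times> 'b)"
    and A :: "complex^'a^'a" and B :: "complex^'b^'b"
  assumes \<rho>: "density_operator \<rho>"
    and D: "D\<^sub>A = (real CARD('a) - 1) / real CARD('a)" "D\<^sub>B = (real CARD('b) - 1) / real CARD('b)"
    and A: "mat_adjoint A = A" "inner A (mat 1) = 0" "inner A A = D\<^sub>A"
    and B: "mat_adjoint B = B" "inner B (mat 1) = 0" "inner B B = D\<^sub>B"
    and \<rho>A: "partial_trace_B \<rho> = (1 / real CARD('a)) *\<^sub>R mat 1 + x *\<^sub>R A"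
    and \<rho>B: "partial_trace_A \<rho> = (1 / real CARD('b)) *\<^sub>R mat 1 + y *\<^sub>R B"
    and xy: "1 \<le> x + y"
  shows "1 - D\<^sub>A * (1 - x\<^sup>2) - D\<^sub>B * (1 - y\<^sup>2) + 2 * D\<^sub>A * D\<^sub>B * (1 - x) * (1 - y) \<le> inner \<rho> \<rho>"
proof -
  define d e where "d = real CARD('a)" and "e = real CARD('b)"
  define t where "t = x + y - 1"
  define U where "U = kron A B"
  define K where "K = kron A (mat 1 :: complex^'b^'b)"
  define L where "L = kron (mat 1 :: complex^'a^'a) B"
  define I where "I = (mat 1 :: complex^('a \<times> 'b)^('a \<times> 'b))"
  have pos: "0 < d" "0 < e" by (auto simp: d_def e_def)
  have A1: "inner (mat 1) A = 0" and B1: "inner (mat 1) B = 0"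
    using A(2) B(2) by (auto simp: inner_commute)
  have I: "I = kron (mat 1) (mat 1)" by (simp add: I_def kron_mat_1_mat_1)
  have \<rho>I: "inner \<rho> I = 1"
    using \<rho> by (simp add: I_def inner_mat_1 density_operator_def)
  have \<rho>K: "inner \<rho> K = x * D\<^sub>A"
    by (simp add: K_def inner_kron_mat_1_right \<rho>A inner_add_left A1 A(3))
  have \<rho>L: "inner \<rho> L = y * D\<^sub>B"
    by (simp add: L_def inner_kron_mat_1_left \<rho>B inner_add_left B1 B(3))
  have "0 \<le> inner \<rho> (kron (D\<^sub>A *\<^sub>R mat 1 - A) (D\<^sub>B *\<^sub>R mat 1 - B))"
    using \<rho> A B D by (intro inner_kron_psd_nonneg psd_mat_1_minus_traceless)
      (auto simp: density_operator_def)
  also have "kron (D\<^sub>A *\<^sub>R mat 1 - A) (D\<^sub>B *\<^sub>R mat 1 - B)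
      = (D\<^sub>A * D\<^sub>B) *\<^sub>R I - D\<^sub>A *\<^sub>R L - D\<^sub>B *\<^sub>R K + U"
    by (simp add: kron_diff_left kron_diff_right kron_scaleR_left kron_scaleR_right I K_def L_def U_def
        algebra_simps)
  finally have \<rho>U: "D\<^sub>A * D\<^sub>B * t \<le> inner \<rho> U"
    by (simp add: inner_add_right inner_diff_right \<rho>I \<rho>K \<rho>L t_def algebra_simps)
  \<comment> \<open>\<open>Z\<close> has minimal norm among the matrices with the reduced states of \<open>\<rho>\<close> and
    \<open>inner Z U = D\<^sub>A * D\<^sub>B * t\<close>.\<close>
  define Z where "Z = (1 / (d * e)) *\<^sub>R I + (x / e) *\<^sub>R K + (y / d) *\<^sub>R L + t *\<^sub>R U"
  note kron_inner = inner_kron_kron[OF mat_adjoint_mat_1 mat_adjoint_mat_1]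
    inner_kron_kron[OF mat_adjoint_mat_1 A(1)]
    inner_kron_kron[OF A(1) mat_adjoint_mat_1]
    inner_kron_kron[OF A(1) A(1)]
  \<comment> \<open>\<open>I\<close>, \<open>K\<close>, \<open>L\<close>, \<open>U\<close> are
    pairwise orthogonal since \<open>A\<close> and \<open>B\<close> are traceless, so only their
    squared norms \<open>d * e\<close>, \<open>e * D\<^sub>A\<close>, \<open>d * D\<^sub>B\<close>,
    \<open>D\<^sub>A * D\<^sub>B\<close> contribute.\<close>
  have "inner Z Z = 1 / (d * e) + x\<^sup>2 * D\<^sub>A / e + y\<^sup>2 * D\<^sub>B / d + t\<^sup>2 * (D\<^sub>A * D\<^sub>B)"
    using pos by (simp add: Z_def I K_def L_def U_def inner_add_left inner_add_right kron_inner
        A B A1 B1 inner_mat_1_mat_1 flip: d_def e_def) (simp add: field_simps power2_eq_square)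
  moreover have "1 / (d * e) + x\<^sup>2 * D\<^sub>A / e + y\<^sup>2 * D\<^sub>B / d + t\<^sup>2 * (D\<^sub>A * D\<^sub>B) \<le> inner \<rho> Z"
  proof -
    \<comment> \<open>The sign of \<open>t\<close>, hence \<open>1 \<le> x + y\<close>, matters
      here: the lower bound on the correlation is multiplied by \<open>t\<close>.\<close>
    have "t * (D\<^sub>A * D\<^sub>B * t) \<le> t * inner \<rho> U"
      using \<rho>U xy by (intro mult_left_mono) (auto simp: t_def)
    then show ?thesis
      by (simp add: Z_def inner_add_right \<rho>I \<rho>K \<rho>L power2_eq_square mult_ac)
  qed
  \<comment> \<open>Expanding gives
    \<open>inner \<rho> \<rho> \<ge> 2 * inner \<rho> Z - inner Z Z\<close>, which is at least
    \<open>inner Z Z\<close>.\<close>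
  moreover have "0 \<le> inner (\<rho> - Z) (\<rho> - Z)" by simp
  ultimately have "1 / (d * e) + x\<^sup>2 * D\<^sub>A / e + y\<^sup>2 * D\<^sub>B / d + t\<^sup>2 * (D\<^sub>A * D\<^sub>B) \<le> inner \<rho> \<rho>"
    by (simp add: inner_diff_left inner_diff_right inner_commute[of Z \<rho>])
  \<comment> \<open>Eliminating the dimensions leaves a polynomial identity in
    \<open>D\<^sub>A\<close>, \<open>D\<^sub>B\<close>, \<open>x\<close>, \<open>y\<close>.\<close>
  moreover have inv: "inverse d = 1 - D\<^sub>A" "inverse e = 1 - D\<^sub>B"
    using pos by (simp_all add: D field_simps flip: d_def e_def)
  have "1 / (d * e) + x\<^sup>2 * D\<^sub>A / e + y\<^sup>2 * D\<^sub>B / d + t\<^sup>2 * (D\<^sub>A * D\<^sub>B)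
    = (1 - D\<^sub>A) * (1 - D\<^sub>B) + x\<^sup>2 * D\<^sub>A * (1 - D\<^sub>B) + y\<^sup>2 * D\<^sub>B * (1 - D\<^sub>A) + t\<^sup>2 * (D\<^sub>A * D\<^sub>B)"
    by (simp only: divide_inverse inverse_mult_distrib inv mult_1_left)
  ultimately show ?thesis
    by (simp add: t_def power2_eq_square algebra_simps)
qed

theorem theorem3:
  fixes \<rho>\<^sub>A\<^sub>B :: "complex^('a::finite \<times> 'b::finite)^('a \<times> 'b)"
    and \<rho>\<^sub>A :: "complex^'a^'a"
    and \<rho>\<^sub>B :: "complex^'b^'b"
    and D\<^sub>A D\<^sub>B :: real
  assumes "CARD('a) \<ge> 2" and "CARD('b) \<ge> 2"
    and "D\<^sub>A = (real CARD('a) - 1) / real CARD('a)"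
    and "D\<^sub>B = (real CARD('b) - 1) / real CARD('b)"
    and "density_operator \<rho>\<^sub>A\<^sub>B"
    and "\<rho>\<^sub>A = partial_trace_B \<rho>\<^sub>A\<^sub>B"
    and "\<rho>\<^sub>B = partial_trace_A \<rho>\<^sub>A\<^sub>B"
    and "linear_entropy \<rho>\<^sub>A
           \<le> D\<^sub>A * (linear_entropy \<rho>\<^sub>B / D\<^sub>B - 1 + 2 * sqrt (1 - linear_entropy \<rho>\<^sub>B / D\<^sub>B))"
  shows "linear_entropy \<rho>\<^sub>A\<^sub>B
           \<le> linear_entropy \<rho>\<^sub>A + linear_entropy \<rho>\<^sub>B
             - 2 * D\<^sub>A * D\<^sub>B * (1 - sqrt (1 - linear_entropy \<rho>\<^sub>A / D\<^sub>A))
                           * (1 - sqrt (1 - linear_entropy \<rho>\<^sub>B / D\<^sub>B))"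
proof -
  have herm: "mat_adjoint \<rho>\<^sub>A\<^sub>B = \<rho>\<^sub>A\<^sub>B" and tr: "trace \<rho>\<^sub>A\<^sub>B = 1"
    using assms(5) by (auto simp: density_operator_def positive_semidefinite_def)
  have hermA: "mat_adjoint \<rho>\<^sub>A = \<rho>\<^sub>A" and trA: "trace \<rho>\<^sub>A = 1"
    using herm tr by (simp_all add: assms(6) mat_adjoint_partial_trace_B trace_partial_trace_B)
  have hermB: "mat_adjoint \<rho>\<^sub>B = \<rho>\<^sub>B" and trB: "trace \<rho>\<^sub>B = 1"
    using herm tr by (simp_all add: assms(7) mat_adjoint_partial_trace_A trace_partial_trace_A)
  define x where "x = sqrt (1 - linear_entropy \<rho>\<^sub>A / D\<^sub>A)"
  define y where "y = sqrt (1 - linear_entropy \<rho>\<^sub>B / D\<^sub>B)"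
  obtain A where A: "mat_adjoint A = A" "inner A (mat 1) = 0" "inner A A = D\<^sub>A"
    "\<rho>\<^sub>A = (1 / real CARD('a)) *\<^sub>R mat 1 + x *\<^sub>R A" "0 \<le> x"
    and SA: "linear_entropy \<rho>\<^sub>A = D\<^sub>A * (1 - x\<^sup>2)"
    using bloch_decomposition[OF hermA trA assms(1,3)] unfolding x_def by blast
  obtain B where B: "mat_adjoint B = B" "inner B (mat 1) = 0" "inner B B = D\<^sub>B"
    "\<rho>\<^sub>B = (1 / real CARD('b)) *\<^sub>R mat 1 + y *\<^sub>R B"
    and SB: "linear_entropy \<rho>\<^sub>B = D\<^sub>B * (1 - y\<^sup>2)"
    using bloch_decomposition[OF hermB trB assms(2,4)] unfolding y_def by blast
  have "0 < D\<^sub>A" "0 < D\<^sub>B"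
    using assms(1-4) by simp_all
  have "linear_entropy \<rho>\<^sub>B / D\<^sub>B = 1 - y\<^sup>2"
    using \<open>0 < D\<^sub>B\<close> by (simp add: SB)
  then have "D\<^sub>A * (1 - x\<^sup>2) \<le> D\<^sub>A * (2 * y - y\<^sup>2)"
    using assms(8) unfolding y_def[symmetric] by (simp add: SA)
  then have "1 - x\<^sup>2 \<le> 2 * y - y\<^sup>2"
    using \<open>0 < D\<^sub>A\<close> by simp
  \<comment> \<open>Completing the square; since \<open>x\<close> is nonnegative, the root can be
    taken whatever the sign of \<open>1 - y\<close>.\<close>
  then have "(1 - y)\<^sup>2 \<le> x\<^sup>2"
    by (simp add: power2_eq_square algebra_simps)
  then have "1 \<le> x + y"
    using power2_le_imp_le[OF _ A(5)] by fastforce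
  then have "1 - D\<^sub>A * (1 - x\<^sup>2) - D\<^sub>B * (1 - y\<^sup>2) + 2 * D\<^sub>A * D\<^sub>B * (1 - x) * (1 - y)
      \<le> inner \<rho>\<^sub>A\<^sub>B \<rho>\<^sub>A\<^sub>B"
    using purity_lower_bound[OF assms(5,3,4) A(1-3) B(1-3)] A(4) B(4) assms(6,7) by simp
  then show ?thesis
    unfolding x_def[symmetric] y_def[symmetric]
    by (simp add: SA SB linear_entropy_def[of \<rho>\<^sub>A\<^sub>B] inner_self_eq_trace[OF herm])
qed

end
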